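(* (Maximum principle.) Assume the monotonicity condition (M) stated in the context holds. Then, for all $n\in\{0,\dots,N\}$ and all $\boldsymbol{j}\in\{0,\dots,J-1\}^2$, $$f^n_{i,\boldsymbol{j}}\in[f^{\mathrm{eq}}_i(-u_\infty),f^{\mathrm{eq}}_i(u_\infty)]\quad\text{for all } i\in I,\qquad\text{and}\qquad u^n_{\boldsymbol{j}}\in[-u_\infty,u_\infty].$$
   Context: Setting (scalar two-relaxation-times D2Q5 lattice Boltzmann scheme on the unit square, with equilibrium boundary conditions). $\boldsymbol{x}=(x,y)$; $\boldsymbol{e}_x=(1,0)$, $\boldsymbol{e}_y=(0,1)$. Data and parameters. $T>0$ and $\lambda>0$ are fixed. Fluxes $\varphi_x,\varphi_y\in C^1(\mathbb{R})$ with $\varphi_x(0)=\varphi_y(0)=0$. Initial datum $u^\circ\in L^\infty\cap BV\cap L^1((0,1)^2)$. Boundary data $\tilde u_\alpha\in L^\infty\cap BV\cap L^1((0,T)\times(0,1))$ for $\alpha\in\{W,E,S,Nth\}$ (west $x=0$, east $x=1$, south $y=0$, north $y=1$). Set $u_\infty:=\max(\|u^\circ\|_{L^\infty},\max_\alpha\|\tilde u_\alpha\|_{L^\infty})$. Relaxation parameters $\omega_s,\omega_a\in(0,2]$ and $L_x,L_y\in\mathbb{R}$. Grid. $J\ge1$ integer, $\Delta x:=1/J$, $\Delta t:=\Delta x/\lambda$, with $N\Delta t=T$ for some integer $N\ge1$; $t^n:=n\Delta t$. Cells $C_{\boldsymbol{j}}:=(j_x\Delta x,(j_x+1)\Delta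 x)\times(j_y\Delta x,(j_y+1)\Delta x)$, $\boldsymbol{j}=(j_x,j_y)\in\{0,\dots,J-1\}^2$. Equilibria. Index set $I=\{0,x+,x-,y+,y-\}$ and $f^{\mathrm{eq}}_0(u)=(1-2L_x-2L_y)u$, $f^{\mathrm{eq}}_{x\pm}(u)=L_xu\pm\frac{1}{2\lambda}\varphi_x(u)$, $f^{\mathrm{eq}}_{y\pm}(u)=L_yu\pm\frac{1}{2\lambda}\varphi_y(u)$. Scheme. Initialization: $f^0_{i,\boldsymbol{j}}=f^{\mathrm{eq}}_i\big(\frac{1}{\Delta x^2}\int_{C_{\boldsymbol{j}}}u^\circ\,d\boldsymbol{x}\big)$. For $n=0,\dots,N-1$, with $u^n_{\boldsymbol{j}}:=\sum_{i\in I}f^n_{i,\boldsymbol{j}}$ (at all times), relaxation: $f^{n,\star}_{0,\boldsymbol{j}}=(1-\omega_s)f^n_{0,\boldsymbol{j}}+\omega_sf^{\mathrm{eq}}_0(u^n_{\boldsymbol{j}})$ and, for $a\in\{x,y\}$, $$f^{n,\star}_{a\pm,\boldsymbol{j}}=\big(1-\tfrac12(\omega_s+\omega_a)\big)f^n_{a\pm,\boldsymbol{j}}+\tfrac12(\omega_s+\omega_a)f^{\mathrm{eq}}_{a\pm}(u^n_{\boldsymbol{j}})+\tfrac12(\omega_s-\omega_a)\big(f^{\mathrm{eq}}_{a\mp}(u^n_{\boldsymbol{j}})-f^n_{a\mp,\boldsymbol{j}}\big).$$ Transport: $f^{n+1}_{0,\boldsymbol{j}}=f^{n,\star}_{0,\boldsymbol{j}}$,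 $f^{n+1}_{a\pm,\boldsymbol{j}}=f^{n,\star}_{a\pm,\boldsymbol{j}\mp\boldsymbol{e}_a}$ for $a\in\{x,y\}$, where the ghost values are $f^{n,\star}_{x+,(-1,j_y)}=f^{\mathrm{eq}}_{x+}(\tilde u^n_{W,j_y})$, $f^{n,\star}_{x-,(J,j_y)}=f^{\mathrm{eq}}_{x-}(\tilde u^n_{E,j_y})$, $f^{n,\star}_{y+,(j_x,-1)}=f^{\mathrm{eq}}_{y+}(\tilde u^n_{S,j_x})$, $f^{n,\star}_{y-,(j_x,J)}=f^{\mathrm{eq}}_{y-}(\tilde u^n_{Nth,j_x})$, with $\tilde u^n_{\alpha,j}:=\frac{1}{\Delta t\Delta x}\int_{t^n}^{t^{n+1}}\int_{j\Delta x}^{(j+1)\Delta x}\tilde u_\alpha(t,s)\,ds\,dt$. Monotonicity condition (M): $$\omega_s(1-2L_x-2L_y)\ge\max(0,\omega_s-1),\qquad \frac{\omega_a}{2}\max_{|u|\le u_\infty}\frac{|\varphi_a'(u)|}{\lambda}\le\omega_sL_a+\tfrac12\min(2-\omega_s-\omega_a,0,\omega_a-\omega_s)\quad(a=x,y).$$ The trivial case where both $\max_{|u|\le u_\infty}|\varphi_x'(u)|=0$ and $\max_{|u|\le u_\infty}|\varphi_y'(u)|=0$ is excluded throughout. *)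

theory Defs
  imports "HOL-Analysis.Analysis" "HOL-Probability.Essential_Supremum"
begin

section \<open>Function spaces on a Lebesgue measurable set\<close>

definition L1 :: "'a::euclidean_space set \<Rightarrow> ('a \<Rightarrow> real) set" where
  "L1 \<Omega> = {u. integrable (lebesgue_on \<Omega>) u}"

definition Linf_enorm :: "'a::euclidean_space set \<Rightarrow> ('a \<Rightarrow> real) \<Rightarrow> ereal" where
  "Linf_enorm \<Omega> u = esssup (lebesgue_on \<Omega>) (\<lambda>x. ereal \<bar>u x\<bar>)"

definition Linf :: "'a::euclidean_space set \<Rightarrow> ('a \<Rightarrow> real) set" where
  "Linf \<Omega> = {u. u \<in> borel_measurable (lebesgue_on \<Omega>) \<and> Linf_enorm \<Omega> u < \<infinity>}"

definition Linf_norm :: "'a::euclidean_space set \<Rightarrow> ('a \<Rightarrow> real) \<Rightarrow> real" where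
  "Linf_norm \<Omega> u = real_of_ereal (Linf_enorm \<Omega> u)"

definition test_fields :: "'a::euclidean_space set \<Rightarrow> ('a \<Rightarrow> 'a) set" where
  "test_fields \<Omega> = {v.
     compact (closure {x. v x \<noteq> 0}) \<and> closure {x. v x \<noteq> 0} \<subseteq> \<Omega> \<and>
     (\<exists>D :: 'a \<Rightarrow> 'a \<Rightarrow>\<^sub>L 'a. (\<forall>x. (v has_derivative blinfun_apply (D x)) (at x)) \<and>
                         continuous_on UNIV D)}"

definition divergence :: "('a::euclidean_space \<Rightarrow> 'a) \<Rightarrow> 'a \<Rightarrow> real" where
  "divergence v x = (\<Sum>b\<in>Basis. frechet_derivative v (at x) b \<bullet> b)"

text \<open>Distributional definition: the total variation
  \<open>sup {\<integral>\<^sub>\<Omega> u div v | v \<in> C\<^sub>c\<^sup>1(\<Omega>), \<parallel>v\<parallel>\<^sub>\<infinity> \<le> 1}\<close> is finite.\<close>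

definition BV :: "'a::euclidean_space set \<Rightarrow> ('a \<Rightarrow> real) set" where
  "BV \<Omega> = {u \<in> L1 \<Omega>.
     bdd_above {(LINT x:\<Omega>|lebesgue. u x * divergence v x) | v.
                  v \<in> test_fields \<Omega> \<and> (\<forall>x. norm (v x) \<le> 1)}}"

section \<open>The two-relaxation-times D2Q5 scheme with equilibrium boundary conditions\<close>

datatype axis = Xax | Yax

datatype side = West | East | South | North

datatype dir = Rest | Pos axis | Neg axis

definition dx :: "nat \<Rightarrow> real" where
  "dx J = 1 / real J"

definition dt :: "real \<Rightarrow> nat \<Rightarrow> real" where
  "dt lam J = dx J / lam"

definition cell :: "nat \<Rightarrow> int \<times> int \<Rightarrow> (real \<times> real) set" where
  "cell J j = {of_int (fst j) * dx J <..< of_int (fst j + 1) * dx J} \<times>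
              {of_int (snd j) * dx J <..< of_int (snd j + 1) * dx J}"

definition cell_avg :: "nat \<Rightarrow> (real \<times> real \<Rightarrow> real) \<Rightarrow> int \<times> int \<Rightarrow> real" where
  "cell_avg J u0 j = 1 / (dx J)\<^sup>2 * (LINT z:cell J j|lebesgue. u0 z)"

text \<open>A boundary datum depends on \<open>(t, s)\<close>, with \<open>t\<close> the time and \<open>s\<close> the coordinate along
  the side.\<close>

definition bdry_avg :: "real \<Rightarrow> nat \<Rightarrow> (real \<times> real \<Rightarrow> real) \<Rightarrow> nat \<Rightarrow> int \<Rightarrow> real" where
  "bdry_avg lam J ub n k = 1 / (dt lam J * dx J) *
     (LINT t:{real n * dt lam J <..< real (n + 1) * dt lam J}|lebesgue.
        (LINT s:{of_int k * dx J <..< of_int (k + 1) * dx J}|lebesgue. ub (t, s)))"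

fun feq :: "real \<Rightarrow> (axis \<Rightarrow> real \<Rightarrow> real) \<Rightarrow> (axis \<Rightarrow> real) \<Rightarrow> dir \<Rightarrow> real \<Rightarrow> real" where
  "feq lam \<phi> L Rest u = (1 - 2 * L Xax - 2 * L Yax) * u"
| "feq lam \<phi> L (Pos a) u = L a * u + 1 / (2 * lam) * \<phi> a u"
| "feq lam \<phi> L (Neg a) u = L a * u - 1 / (2 * lam) * \<phi> a u"

definition conserved :: "(dir \<Rightarrow> real) \<Rightarrow> real" where
  "conserved g = (\<Sum>i\<in>{Rest, Pos Xax, Neg Xax, Pos Yax, Neg Yax}. g i)"

fun relax :: "real \<Rightarrow> (axis \<Rightarrow> real \<Rightarrow> real) \<Rightarrow> (axis \<Rightarrow> real) \<Rightarrow> real \<Rightarrow> real \<Rightarrow>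
    (dir \<Rightarrow> real) \<Rightarrow> dir \<Rightarrow> real" where
  "relax lam \<phi> L ws wa g Rest =
     (1 - ws) * g Rest + ws * feq lam \<phi> L Rest (conserved g)"
| "relax lam \<phi> L ws wa g (Pos a) =
     (1 - 1/2 * (ws + wa)) * g (Pos a) + 1/2 * (ws + wa) * feq lam \<phi> L (Pos a) (conserved g)
     + 1/2 * (ws - wa) * (feq lam \<phi> L (Neg a) (conserved g) - g (Neg a))"
| "relax lam \<phi> L ws wa g (Neg a) =
     (1 - 1/2 * (ws + wa)) * g (Neg a) + 1/2 * (ws + wa) * feq lam \<phi> L (Neg a) (conserved g)
     + 1/2 * (ws - wa) * (feq lam \<phi> L (Pos a) (conserved g) - g (Pos a))"

text \<open>\<open>transport b g\<close> streams the post-relaxation values \<open>g\<close>; \<open>b \<alpha> i k\<close> is the ghost value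
  of component \<open>i\<close> across side \<open>\<alpha>\<close> at position \<open>k\<close>.\<close>

fun transport :: "nat \<Rightarrow> (side \<Rightarrow> dir \<Rightarrow> int \<Rightarrow> real) \<Rightarrow> (dir \<Rightarrow> int \<times> int \<Rightarrow> real) \<Rightarrow>
    dir \<Rightarrow> int \<times> int \<Rightarrow> real" where
  "transport J b g Rest (jx, jy) = g Rest (jx, jy)"
| "transport J b g (Pos Xax) (jx, jy) =
     (if jx - 1 = -1 then b West (Pos Xax) jy else g (Pos Xax) (jx - 1, jy))"
| "transport J b g (Neg Xax) (jx, jy) =
     (if jx + 1 = int J then b East (Neg Xax) jy else g (Neg Xax) (jx + 1, jy))"
| "transport J b g (Pos Yax) (jx, jy) =
     (if jy - 1 = -1 then b South (Pos Yax) jx else g (Pos Yax) (jx, jy - 1))"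
| "transport J b g (Neg Yax) (jx, jy) =
     (if jy + 1 = int J then b North (Neg Yax) jx else g (Neg Yax) (jx, jy + 1))"

text \<open>The values of \<open>lbm\<close> are meaningful only at indices in \<open>{0..J-1} \<times> {0..J-1}\<close>; there they
  depend on no value at an index outside the grid other than the ghost values.\<close>

primrec lbm :: "real \<Rightarrow> (axis \<Rightarrow> real \<Rightarrow> real) \<Rightarrow> (axis \<Rightarrow> real) \<Rightarrow> real \<Rightarrow> real \<Rightarrow> nat \<Rightarrow>
    (real \<times> real \<Rightarrow> real) \<Rightarrow> (side \<Rightarrow> real \<times> real \<Rightarrow> real) \<Rightarrow>
    nat \<Rightarrow> dir \<Rightarrow> int \<times> int \<Rightarrow> real" where
  "lbm lam \<phi> L ws wa J u0 ub 0 = (\<lambda>i j. feq lam \<phi> L i (cell_avg J u0 j))"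
| "lbm lam \<phi> L ws wa J u0 ub (Suc n) =
     transport J (\<lambda>\<alpha> i k. feq lam \<phi> L i (bdry_avg lam J (ub \<alpha>) n k))
       (\<lambda>i j. relax lam \<phi> L ws wa (\<lambda>i'. lbm lam \<phi> L ws wa J u0 ub n i' j) i)"

definition u_inf :: "real \<Rightarrow> (real \<times> real \<Rightarrow> real) \<Rightarrow> (side \<Rightarrow> real \<times> real \<Rightarrow> real) \<Rightarrow> real" where
  "u_inf T u0 ub = max (Linf_norm ({0<..<1} \<times> {0<..<1}) u0)
     (MAX \<alpha>\<in>{West, East, South, North}. Linf_norm ({0<..<T} \<times> {0<..<1}) (ub \<alpha>))"

text \<open>The library's \<open>Max\<close> is for finite sets only; for \<open>\<phi> a\<close> of class \<open>C\<^sup>1\<close> and \<open>U \<ge> 0\<close>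
  the supremum below is attained.\<close>

definition max_abs_deriv :: "(real \<Rightarrow> real) \<Rightarrow> real \<Rightarrow> real" where
  "max_abs_deriv f U = (SUP w\<in>{-U..U}. \<bar>deriv f w\<bar>)"

definition monotonicity_cond :: "real \<Rightarrow> (axis \<Rightarrow> real \<Rightarrow> real) \<Rightarrow> (axis \<Rightarrow> real) \<Rightarrow>
    real \<Rightarrow> real \<Rightarrow> real \<Rightarrow> bool" where
  "monotonicity_cond lam \<phi> L ws wa U \<longleftrightarrow>
     ws * (1 - 2 * L Xax - 2 * L Yax) \<ge> max 0 (ws - 1) \<and>
     (\<forall>a. wa / 2 * (max_abs_deriv (\<phi> a) U / lam)
            \<le> ws * L a + 1/2 * min (2 - ws - wa) (min 0 (wa - ws)))"

end

theory Submission imports Defs begin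

text \<open>Under (M) the post-relaxation values are nondecreasing in each of the five pre-relaxation
  values, as long as the conserved quantity stays in \<open>[-U, U]\<close>, and every equilibrium function is
  nondecreasing on \<open>[-U, U]\<close>. Equilibria are fixed points of the relaxation and the equilibrium
  values of \<open>\<plusminus>U\<close> sum up to \<open>\<plusminus>U\<close>, so the box of the statement is invariant under the relaxation.
  Cell and boundary averages lie in \<open>[-U, U]\<close>, hence the initial and ghost values lie in the box,
  and transport only moves values.\<close>

section \<open>Essential bounds and averages\<close>

text \<open>On a space of measure zero the essential supremum is \<open>-\<infinity>\<close>, which
  \<open>real_of_ereal\<close> sends to 0; on any other space it dominates that of the constant
  0.\<close>

lemma Linf_norm_nonneg:
  assumes "u \<in> Linf \<Omega>"
  shows "0 \<le> Linf_norm \<Omega> u"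
proof (cases "emeasure (lebesgue_on \<Omega>) (space (lebesgue_on \<Omega>)) = 0")
  case True
  then have "Linf_enorm \<Omega> u = -\<infinity>"
    using assms unfolding Linf_enorm_def Linf_def by (intro esssup_zero_space) auto
  then show ?thesis
    by (simp add: Linf_norm_def)
next
  case False
  have "esssup (lebesgue_on \<Omega>) (\<lambda>x. 0 :: ereal) \<le> Linf_enorm \<Omega> u"
    unfolding Linf_enorm_def by (intro esssup_mono) auto
  moreover have "esssup (lebesgue_on \<Omega>) (\<lambda>x. 0 :: ereal) = 0"
    using False by (intro esssup_const)
  ultimately show ?thesis
    by (simp add: Linf_norm_def real_of_ereal_pos)
qed

text \<open>The null set is taken in \<open>lborel\<close>, not in \<open>lebesgue\<close>, so that
  on the plane it can be split by coordinates for the iterated boundary integrals.\<close>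

lemma Linf_AE_bound:
  assumes "u \<in> Linf \<Omega>" and "\<Omega> \<in> sets lebesgue"
  shows "AE x in lborel. x \<in> \<Omega> \<longrightarrow> \<bar>u x\<bar> \<le> Linf_norm \<Omega> u"
proof -
  have fin: "Linf_enorm \<Omega> u < \<infinity>"
    using assms(1) unfolding Linf_def by auto
  have "AE x in lebesgue_on \<Omega>. ereal \<bar>u x\<bar> \<le> Linf_enorm \<Omega> u"
    unfolding Linf_enorm_def by (rule esssup_AE)
  then have "AE x in lebesgue_on \<Omega>. \<bar>u x\<bar> \<le> Linf_norm \<Omega> u"
  proof eventually_elim
    case (elim x)
    with fin show ?case
      \<comment> \<open>The value \<open>\<infinity>\<close> is excluded by \<open>fin\<close>;
        \<open>-\<infinity>\<close> cannot bound \<open>ereal \<bar>u x\<bar>\<close> from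
        above.\<close>
      by (cases "Linf_enorm \<Omega> u") (auto simp: Linf_norm_def)
  qed
  then have "AE x in lebesgue. x \<in> \<Omega> \<longrightarrow> \<bar>u x\<bar> \<le> Linf_norm \<Omega> u"
    using assms(2) by (subst (asm) AE_restrict_space_iff) auto
  then show ?thesis
    by (simp add: AE_completion_iff)
qed

text \<open>No integrability is assumed: the Bochner integral of a non-integrable function is 0.\<close>

lemma abs_set_lebesgue_integral_le:
  fixes f :: "'a \<Rightarrow> real"
  assumes A: "A \<in> sets M" "emeasure M A < \<infinity>" and K: "0 \<le> K"
    and bd: "AE x in M. x \<in> A \<longrightarrow> \<bar>f x\<bar> \<le> K"
  shows "\<bar>LINT x:A|M. f x\<bar> \<le> K * measure M A"
proof (cases "set_integrable M A f")
  case True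
  have "\<bar>LINT x:A|M. f x\<bar> \<le> (LINT x|M. norm (indicator A x *\<^sub>R f x))"
    unfolding set_lebesgue_integral_def by (metis integral_norm_bound real_norm_def)
  also have "\<dots> \<le> (LINT x|M. K * indicator A x)"
  proof (rule integral_mono_AE)
    show "integrable M (\<lambda>x. norm (indicator A x *\<^sub>R f x))"
      using True unfolding set_integrable_def by (rule integrable_norm)
    show "integrable M (\<lambda>x. K * indicator A x)"
      using A by (intro integrable_mult_right integrable_real_indicator)
    show "AE x in M. norm (indicator A x *\<^sub>R f x) \<le> K * indicator A x"
      using bd by eventually_elim (auto simp: indicator_def)
  qed
  also have "\<dots> = K * measure M A"
    using A sets.sets_into_space[of A M] by (simp add: Int_absorb2)
  finally show ?thesis .
next
  case False
  then show ?thesis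
    using K unfolding set_lebesgue_integral_def set_integrable_def
    by (simp add: not_integrable_integral_eq)
qed

section \<open>Averages over cells and boundary segments\<close>

lemma grid_interval_subset:
  assumes J: "J \<ge> 1" and k: "k \<in> {0..int J - 1}"
  shows "{of_int k * dx J <..< of_int (k + 1) * dx J} \<subseteq> {0<..<1}"
proof -
  have d: "dx J > 0" "real J * dx J = 1"
    using J by (auto simp: dx_def)
  have "real_of_int (k + 1) \<le> real J" "0 \<le> real_of_int k"
    using k by auto
  then have "of_int (k + 1) * dx J \<le> real J * dx J" "0 \<le> of_int k * dx J"
    using d by (intro mult_right_mono mult_nonneg_nonneg; simp)+
  then show ?thesis
    unfolding d by auto
qed

lemma cell_avg_bound:
  assumes J: "J \<ge> 1" and j: "j \<in> {0..int J - 1} \<times> {0..int J - 1}" and K: "0 \<le> K"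
    and bd: "AE z in lborel. z \<in> {0<..<1} \<times> {0<..<1} \<longrightarrow> \<bar>u z\<bar> \<le> K"
  shows "cell_avg J u j \<in> {-K..K}"
proof -
  obtain p q where jj: "j = (p, q)" by force
  define A where "A = {of_int p * dx J <..< of_int (p + 1) * dx J}"
  define B where "B = {of_int q * dx J <..< of_int (q + 1) * dx J}"
  have d: "dx J > 0" "real J * dx J = 1"
    using J by (auto simp: dx_def)
  have AB: "cell J j = A \<times> B"
    by (simp add: cell_def A_def B_def jj)
  have sets: "A \<times> B \<in> sets lborel"
    unfolding A_def B_def by (simp add: borel_open open_Times)
  have e: "emeasure lborel (A \<times> B) = ennreal ((dx J)\<^sup>2)"
  proof -
    have "emeasure lborel A = ennreal (dx J)" "emeasure lborel B = ennreal (dx J)"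
      using d unfolding A_def B_def by (auto simp: algebra_simps)
    then have "emeasure (lborel \<Otimes>\<^sub>M lborel) (A \<times> B) = ennreal (dx J) * ennreal (dx J)"
      by (subst lborel.emeasure_pair_measure_Times) (auto simp: A_def B_def)
    then show ?thesis
      using d by (simp add: lborel_prod ennreal_mult power2_eq_square)
  qed
  have e': "emeasure lebesgue (A \<times> B) = ennreal ((dx J)\<^sup>2)"
    using e sets by simp
  have "A \<times> B \<subseteq> {0<..<1} \<times> {0<..<1}"
    using j J grid_interval_subset unfolding jj A_def B_def by (intro Sigma_mono) auto
  then have "AE z in lebesgue. z \<in> A \<times> B \<longrightarrow> \<bar>u z\<bar> \<le> K"
    unfolding AE_completion_iff using bd by (auto elim!: eventually_mono)
  then have "\<bar>LINT z:A \<times> B|lebesgue. u z\<bar> \<le> K * measure lebesgue (A \<times> B)"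
    using sets e' K by (intro abs_set_lebesgue_integral_le) auto
  also have "measure lebesgue (A \<times> B) = (dx J)\<^sup>2"
    unfolding measure_def e' by simp
  finally have "\<bar>cell_avg J u j\<bar> \<le> K"
    using d by (simp add: cell_avg_def AB abs_mult field_simps)
  then show ?thesis
    by auto
qed

text \<open>By Fubini for null sets, for almost every \<open>t\<close> the bound holds for almost
  every \<open>s\<close>. Estimating the inner and then the outer integral produces the factors
  \<open>dx J\<close> and \<open>dt lam J\<close>, which the prefactor cancels.\<close>

lemma bdry_avg_bound:
  assumes J: "J \<ge> 1" and lam: "lam > 0" and n: "n < N" and T: "real N * dt lam J = T"
    and k: "k \<in> {0..int J - 1}" and K: "0 \<le> K"
    and bd: "AE z in lborel. z \<in> {0<..<T} \<times> {0<..<1} \<longrightarrow> \<bar>u z\<bar> \<le> K"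
  shows "bdry_avg lam J u n k \<in> {-K..K}"
proof -
  define A where "A = {real n * dt lam J <..< real (n + 1) * dt lam J}"
  define B where "B = {of_int k * dx J <..< of_int (k + 1) * dx J}"
  have d: "dx J > 0" "real J * dx J = 1"
    using J by (auto simp: dx_def)
  then have dt: "dt lam J > 0"
    using lam by (simp add: dt_def)
  have B: "B \<subseteq> {0<..<1}"
    unfolding B_def using J k by (rule grid_interval_subset)
  \<comment> \<open>Since \<open>n + 1 \<le> N\<close>, the time slab ends no later than
    \<open>T\<close>.\<close>
  have "real (n + 1) * dt lam J \<le> real N * dt lam J" "0 \<le> real n * dt lam J"
    using dt n by (auto intro!: mult_right_mono)
  then have A: "A \<subseteq> {0<..<T}"
    using T unfolding A_def by auto
  have eA: "emeasure lebesgue A = ennreal (dt lam J)" and eB: "emeasure lebesgue B = ennreal (dx J)"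
    using d dt unfolding A_def B_def by (auto simp: algebra_simps)
  then have mA: "measure lebesgue A = dt lam J" and mB: "measure lebesgue B = dx J"
    using d dt by (simp_all add: measure_def)
  have "AE z in lborel \<Otimes>\<^sub>M lborel. z \<in> {0<..<T} \<times> {0<..<1} \<longrightarrow> \<bar>u z\<bar> \<le> K"
    unfolding lborel_prod by (rule bd)
  then have "AE t in lborel. AE s in lborel. (t, s) \<in> {0<..<T} \<times> {0<..<1} \<longrightarrow> \<bar>u (t, s)\<bar> \<le> K"
    by (rule lborel_pair.AE_pair)
  then have "AE t in lborel. t \<in> A \<longrightarrow> \<bar>LINT s:B|lebesgue. u (t, s)\<bar> \<le> K * dx J"
  proof eventually_elim
    case (elim t)
    show ?case
    proof
      assume "t \<in> A"
      then have "0 < t" "t < T"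
        using A by auto
      with elim B have "AE s in lebesgue. s \<in> B \<longrightarrow> \<bar>u (t, s)\<bar> \<le> K"
        unfolding AE_completion_iff by (auto elim!: eventually_mono)
      then have "\<bar>LINT s:B|lebesgue. u (t, s)\<bar> \<le> K * measure lebesgue B"
        using K eB by (intro abs_set_lebesgue_integral_le) (auto simp: B_def)
      then show "\<bar>LINT s:B|lebesgue. u (t, s)\<bar> \<le> K * dx J"
        by (simp only: mB)
    qed
  qed
  then have "AE t in lebesgue. t \<in> A \<longrightarrow> \<bar>LINT s:B|lebesgue. u (t, s)\<bar> \<le> K * dx J"
    by (simp only: AE_completion_iff)
  then have "\<bar>LINT t:A|lebesgue. LINT s:B|lebesgue. u (t, s)\<bar> \<le> K * dx J * measure lebesgue A"
    using K d eA by (intro abs_set_lebesgue_integral_le) (auto simp: A_def)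
  then have "\<bar>LINT t:A|lebesgue. LINT s:B|lebesgue. u (t, s)\<bar> \<le> K * dx J * dt lam J"
    by (simp only: mA)
  then have "\<bar>bdry_avg lam J u n k\<bar> \<le> K"
    unfolding bdry_avg_def A_def[symmetric] B_def[symmetric]
    using d dt by (simp add: abs_mult field_simps)
  then show ?thesis
    by auto
qed

section \<open>Monotonicity of equilibria and relaxation\<close>

text \<open>Continuity of the derivative on the compact interval makes the set in
  \<open>max_abs_deriv\<close> bounded above, so its \<open>SUP\<close> is a genuine upper
  bound.\<close>

lemma C1_bounded_deriv:
  fixes f :: "real \<Rightarrow> real"
  assumes "f C1_differentiable_on UNIV"
  obtains "\<And>w. (f has_real_derivative deriv f w) (at w)"
    "\<And>U w. w \<in> {-U..U} \<Longrightarrow> \<bar>deriv f w\<bar> \<le> max_abs_deriv f U"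
proof -
  obtain D where D: "\<And>x. (f has_real_derivative D x) (at x)" and c: "continuous_on UNIV D"
    using assms unfolding C1_differentiable_on_def has_real_derivative_iff_has_vector_derivative
    by auto
  have dD: "deriv f = D"
    using D by (auto intro: DERIV_imp_deriv)
  have "\<bar>deriv f w\<bar> \<le> max_abs_deriv f U" if "w \<in> {-U..U}" for U w
  proof -
    have "compact ((\<lambda>w. \<bar>D w\<bar>) ` {-U..U})"
      using c by (intro compact_continuous_image continuous_intros)
        (auto intro: continuous_on_subset)
    then have "bdd_above ((\<lambda>w. \<bar>D w\<bar>) ` {-U..U})"
      by (intro bounded_imp_bdd_above compact_imp_bounded)
    then show ?thesis
      unfolding max_abs_deriv_def dD using that by (intro cSUP_upper)
  qed
  with D dD that show thesis
    by metis
qed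

lemma C1_increment_bound:
  fixes f :: "real \<Rightarrow> real"
  assumes f: "f C1_differentiable_on UNIV" and uv: "-U \<le> u" "u \<le> v" "v \<le> U"
  shows "\<bar>f v - f u\<bar> \<le> max_abs_deriv f U * (v - u)"
proof -
  have "\<And>w. (f has_real_derivative deriv f w) (at w)"
    "\<And>w. w \<in> {-U..U} \<Longrightarrow> norm (deriv f w) \<le> max_abs_deriv f U"
    using f by (auto elim!: C1_bounded_deriv)
  then have "norm (f v - f u) \<le> max_abs_deriv f U * norm (v - u)"
    using uv by (intro field_differentiable_bound[where S = "{-U..U}" and f' = "deriv f"])
      (auto intro: has_field_derivative_at_within)
  then show ?thesis
    using uv by simp
qed

lemma max_abs_deriv_nonneg:
  assumes "f C1_differentiable_on UNIV" and "0 \<le> U"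
  shows "0 \<le> max_abs_deriv f U"
proof -
  have "\<bar>deriv f 0\<bar> \<le> max_abs_deriv f U"
    using assms by (auto elim!: C1_bounded_deriv)
  then show ?thesis
    by linarith
qed

section \<open>Algebra of equilibria and relaxation\<close>

lemma conserved_eq: "conserved g = g Rest + (g (Pos Xax) + g (Neg Xax)) + (g (Pos Yax) + g (Neg Yax))"
  by (simp add: conserved_def)

lemma conserved_feq: "conserved (\<lambda>i. feq lam \<phi> L i u) = u"
  by (simp add: conserved_eq algebra_simps)

lemma relax_feq: "relax lam \<phi> L ws wa (\<lambda>i. feq lam \<phi> L i u) i = feq lam \<phi> L i u"
proof -
  \<comment> \<open>Naming the coefficient keeps \<open>field_simps\<close> from trying to clear the
    denominator \<open>lam\<close>.\<close>
  define c where "c = 1 / (2 * lam)"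
  show ?thesis
    by (cases i) (simp_all only: relax.simps conserved_feq feq.simps c_def[symmetric],
        simp_all add: field_simps)
qed

lemma conserved_mono:
  assumes "\<And>i. g i \<le> h i"
  shows "conserved g \<le> conserved h"
  unfolding conserved_def using assms by (intro sum_mono) auto

section \<open>Consequences of the monotonicity condition\<close>

locale monotone_scheme =
  fixes lam :: real and \<phi> :: "axis \<Rightarrow> real \<Rightarrow> real" and L :: "axis \<Rightarrow> real"
    and ws wa U :: real
  assumes lam: "lam > 0" and C1: "\<And>a. \<phi> a C1_differentiable_on UNIV"
    and ws: "ws > 0" and wa: "wa > 0" and U: "U \<ge> 0"
    and M: "monotonicity_cond lam \<phi> L ws wa U"
begin

text \<open>A Courant number: the largest characteristic speed along \<open>a\<close> relative to
  the lattice speed \<open>lam\<close>.\<close>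

definition slope :: "axis \<Rightarrow> real" where
  "slope a = max_abs_deriv (\<phi> a) U / lam"

lemma slope_nonneg: "0 \<le> slope a"
  unfolding slope_def using max_abs_deriv_nonneg[OF C1 U] lam by simp

lemma rest_cond: "0 \<le> ws * (1 - 2 * L Xax - 2 * L Yax)"
  "ws - 1 \<le> ws * (1 - 2 * L Xax - 2 * L Yax)"
  using M unfolding monotonicity_cond_def by auto

text \<open>The three arguments of the minimum in (M). In \<open>relax_axis_increment\<close> they
  control, in this order, the coefficients of the component itself, of the components off its axis,
  and of the opposite component.\<close>

lemma axis_cond:
  "wa / 2 * slope a \<le> ws * L a + (2 - ws - wa) / 2"
  "wa / 2 * slope a \<le> ws * L a"
  "wa / 2 * slope a \<le> ws * L a + (wa - ws) / 2"
proof -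
  have "wa / 2 * slope a \<le> ws * L a + 1/2 * min (2 - ws - wa) (min 0 (wa - ws))"
    using M unfolding monotonicity_cond_def slope_def by auto
  moreover have "min (2 - ws - wa) (min 0 (wa - ws)) \<le> 2 - ws - wa"
    "min (2 - ws - wa) (min 0 (wa - ws)) \<le> 0"
    "min (2 - ws - wa) (min 0 (wa - ws)) \<le> wa - ws"
    by auto
  ultimately show "wa / 2 * slope a \<le> ws * L a + (2 - ws - wa) / 2"
    "wa / 2 * slope a \<le> ws * L a"
    "wa / 2 * slope a \<le> ws * L a + (wa - ws) / 2"
    by argo+
qed

lemma flux_increment:
  assumes "-U \<le> u" "u \<le> v" "v \<le> U"
  shows "\<bar>1 / (2 * lam) * (\<phi> a v - \<phi> a u)\<bar> \<le> slope a / 2 * (v - u)"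
  using C1_increment_bound[OF C1 assms, of a] lam
  by (simp add: slope_def abs_mult field_simps)

lemma weight_nonneg: "0 \<le> L a"
proof -
  have "0 \<le> ws * L a"
    using axis_cond(2)[of a] slope_nonneg[of a] wa
    by (meson half_gt_zero less_imp_le mult_nonneg_nonneg order_trans)
  then show ?thesis
    using ws by (simp add: zero_le_mult_iff)
qed

text \<open>For \<open>wa < ws\<close> the axis condition must be combined with \<open>slope a \<le> 1\<close>, which follows from
  the rest condition through \<open>L a \<le> 1/2\<close>.\<close>

lemma slope_le: "slope a / 2 \<le> L a"
proof -
  have "0 \<le> 1 - 2 * L Xax - 2 * L Yax"
    using rest_cond(1) ws by (simp add: zero_le_mult_iff)
  then have "L a \<le> 1/2"
    using weight_nonneg[of Xax] weight_nonneg[of Yax] by (cases a) auto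
  then have "ws * L a \<le> ws * (1/2)"
    using ws by (intro mult_left_mono) auto
  \<comment> \<open>After \<open>ws * L a \<le> ws / 2\<close> the terms in \<open>ws\<close> cancel
    in the third axis condition.\<close>
  then have "wa * slope a \<le> wa * 1"
    using axis_cond(3)[of a] by argo
  then have s1: "slope a \<le> 1"
    using wa by (simp add: mult_le_cancel_left)
  have "ws * (slope a / 2) \<le> ws * L a"
  proof (cases "wa \<ge> ws")
    case True
    then have "ws * (slope a / 2) \<le> wa * (slope a / 2)"
      using slope_nonneg[of a] by (intro mult_right_mono) auto
    then show ?thesis
      using axis_cond(2)[of a] by simp
  next
    case False
    \<comment> \<open>In \<open>ws * slope a = (ws - wa) * slope a + wa * slope a\<close> the first
      summand is at most \<open>ws - wa\<close>, which cancels against the third axis condition for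
      the second.\<close>
    then have "(ws - wa) * slope a \<le> (ws - wa) * 1"
      using s1 by (intro mult_left_mono) auto
    then show ?thesis
      using axis_cond(3)[of a] by argo
  qed
  then show ?thesis
    using ws by (simp add: mult_le_cancel_left)
qed

text \<open>By \<open>slope_le\<close> the linear part grows at least as fast as the flux part can
  fall.\<close>

lemma feq_mono:
  assumes "-U \<le> u" "u \<le> v" "v \<le> U"
  shows "feq lam \<phi> L i u \<le> feq lam \<phi> L i v"
proof -
  have *: "\<bar>1 / (2 * lam) * (\<phi> a v - \<phi> a u)\<bar> \<le> L a * (v - u)" for a
    using flux_increment[OF assms, of a] slope_le[of a] assms(2)
    by (meson diff_ge_0_iff_ge mult_right_mono order_trans)
  show ?thesis
  proof (cases i)
    case Rest
    have "0 \<le> 1 - 2 * L Xax - 2 * L Yax"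
      using rest_cond(1) ws by (simp add: zero_le_mult_iff)
    then show ?thesis
      unfolding Rest feq.simps by (rule mult_left_mono[OF assms(2)])
  next
    case (Pos a)
    show ?thesis
      using *[of a] unfolding Pos feq.simps right_diff_distrib abs_le_iff by argo
  next
    case (Neg a)
    show ?thesis
      using *[of a] unfolding Neg feq.simps right_diff_distrib abs_le_iff by argo
  qed
qed

text \<open>Here \<open>d\<close>, \<open>e\<close> and \<open>r\<close> stand for the increments of
  a component, of its opposite and of the other three together, and \<open>m\<close> for a lower
  bound on the growth rate of the equilibrium terms. Collecting terms gives each increment a
  nonnegative coefficient.\<close>

lemma relax_axis_increment:
  fixes m d e r :: real
  assumes m: "ws + wa - 2 \<le> 2 * m" "0 \<le> m" "ws - wa \<le> 2 * m"
    and nn: "0 \<le> d" "0 \<le> e" "0 \<le> r"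
  shows "0 \<le> (1 - 1/2 * (ws + wa)) * d - 1/2 * (ws - wa) * e + m * (d + e + r)"
proof -
  have "0 \<le> (1 - 1/2 * (ws + wa) + m) * d" "0 \<le> (m - 1/2 * (ws - wa)) * e" "0 \<le> m * r"
    by (rule mult_nonneg_nonneg; use m nn in argo)+
  then show ?thesis
    by argo
qed

text \<open>Relaxation evaluates the equilibria only at the conserved quantity, so it is there that
  the range \<open>[-U, U]\<close>, on which (M) controls the fluxes, matters.\<close>

lemma relax_mono:
  assumes gh: "\<And>i. g i \<le> h i" and lo: "-U \<le> conserved g" and hi: "conserved h \<le> U"
  shows "relax lam \<phi> L ws wa g i \<le> relax lam \<phi> L ws wa h i"
proof -
  define u v where "u = conserved g" and "v = conserved h"
  have uv: "-U \<le> u" "u \<le> v" "v \<le> U"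
    using conserved_mono[OF gh] lo hi by (auto simp: u_def v_def)
  have d: "0 \<le> h i - g i" for i
    using gh[of i] by simp
  have vu: "v - u = (h Rest - g Rest) + (h (Pos Xax) - g (Pos Xax)) + (h (Neg Xax) - g (Neg Xax))
      + (h (Pos Yax) - g (Pos Yax)) + (h (Neg Yax) - g (Neg Yax))"
    by (simp add: u_def v_def conserved_eq)
  have axis_le: "(h (Pos a) - g (Pos a)) + (h (Neg a) - g (Neg a)) \<le> v - u" for a
    using d[of Rest] d[of "Pos Xax"] d[of "Neg Xax"] d[of "Pos Yax"] d[of "Neg Yax"]
    unfolding vu by (cases a) auto
  define m where "m a = ws * L a - wa / 2 * slope a" for a
  have m: "ws + wa - 2 \<le> 2 * m a" "0 \<le> m a" "ws - wa \<le> 2 * m a" for a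
    using axis_cond[of a] unfolding m_def by argo+
  \<comment> \<open>In these combinations the linear parts add up to
    \<open>ws * L a * (v - u)\<close> and the fluxes to \<open>wa\<close> times one flux increment,
    up to sign; \<open>flux_increment\<close> bounds the latter.\<close>
  have feq_incr: "m a * (v - u)
        \<le> 1/2 * (ws + wa) * (feq lam \<phi> L (Pos a) v - feq lam \<phi> L (Pos a) u)
          + 1/2 * (ws - wa) * (feq lam \<phi> L (Neg a) v - feq lam \<phi> L (Neg a) u)"
    "m a * (v - u)
        \<le> 1/2 * (ws + wa) * (feq lam \<phi> L (Neg a) v - feq lam \<phi> L (Neg a) u)
          + 1/2 * (ws - wa) * (feq lam \<phi> L (Pos a) v - feq lam \<phi> L (Pos a) u)" for a
  proof -
    define c where "c = 1 / (2 * lam)"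
    have "\<bar>wa * (c * (\<phi> a v - \<phi> a u))\<bar> \<le> wa * (slope a / 2 * (v - u))"
      using mult_left_mono[OF flux_increment[OF uv, of a], of wa] wa
      by (simp add: abs_mult c_def)
    then show "m a * (v - u)
        \<le> 1/2 * (ws + wa) * (feq lam \<phi> L (Pos a) v - feq lam \<phi> L (Pos a) u)
          + 1/2 * (ws - wa) * (feq lam \<phi> L (Neg a) v - feq lam \<phi> L (Neg a) u)"
      "m a * (v - u)
        \<le> 1/2 * (ws + wa) * (feq lam \<phi> L (Neg a) v - feq lam \<phi> L (Neg a) u)
          + 1/2 * (ws - wa) * (feq lam \<phi> L (Pos a) v - feq lam \<phi> L (Pos a) u)"
      unfolding feq.simps c_def[symmetric] m_def abs_le_iff by argo+
  qed
  show ?thesis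
  proof (cases i)
    case Rest
    have r: "h Rest - g Rest \<le> v - u"
      using d[of "Pos Xax"] d[of "Neg Xax"] d[of "Pos Yax"] d[of "Neg Yax"] unfolding vu by auto
    \<comment> \<open>For \<open>ws > 1\<close> the factor \<open>1 - ws\<close> is negative; the
      growth of the rest equilibrium compensates it.\<close>
    have "ws * (1 - 2 * L Xax - 2 * L Yax) * (h Rest - g Rest)
        \<le> ws * (1 - 2 * L Xax - 2 * L Yax) * (v - u)"
      using r rest_cond(1) by (rule mult_left_mono)
    moreover have "(ws - 1) * (h Rest - g Rest) \<le> ws * (1 - 2 * L Xax - 2 * L Yax) * (h Rest - g Rest)"
      using rest_cond(2) d by (rule mult_right_mono)
    ultimately show ?thesis
      unfolding Rest by (simp add: u_def[symmetric] v_def[symmetric] algebra_simps)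
  next
    case (Pos a)
    show ?thesis
      using relax_axis_increment[OF m[of a] d[of "Pos a"] d[of "Neg a"],
          of "v - u - ((h (Pos a) - g (Pos a)) + (h (Neg a) - g (Neg a)))"]
        feq_incr(1)[of a] axis_le[of a]
      unfolding Pos relax.simps u_def[symmetric] v_def[symmetric] by argo
  next
    case (Neg a)
    show ?thesis
      using relax_axis_increment[OF m[of a] d[of "Neg a"] d[of "Pos a"],
          of "v - u - ((h (Pos a) - g (Pos a)) + (h (Neg a) - g (Neg a)))"]
        feq_incr(2)[of a] axis_le[of a]
      unfolding Neg relax.simps u_def[symmetric] v_def[symmetric] by argo
  qed
qed

section \<open>Invariance of the box\<close>

lemma relax_box:
  assumes "\<And>i. g i \<in> {feq lam \<phi> L i (-U)..feq lam \<phi> L i U}"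
  shows "relax lam \<phi> L ws wa g i \<in> {feq lam \<phi> L i (-U)..feq lam \<phi> L i U}"
    and "conserved g \<in> {-U..U}"
proof -
  have lo: "feq lam \<phi> L i (-U) \<le> g i" and hi: "g i \<le> feq lam \<phi> L i U" for i
    using assms[of i] by auto
  have c: "-U \<le> conserved g" "conserved g \<le> U"
    using conserved_mono[of "\<lambda>i. feq lam \<phi> L i (-U)" g, OF lo]
      conserved_mono[of g "\<lambda>i. feq lam \<phi> L i U", OF hi]
    by (simp_all add: conserved_feq)
  then show "conserved g \<in> {-U..U}"
    by simp
  \<comment> \<open>The comparison states are equilibria, which \<open>relax_feq\<close> leaves
    unchanged.\<close>
  have "relax lam \<phi> L ws wa (\<lambda>i. feq lam \<phi> L i (-U)) i \<le> relax lam \<phi> L ws wa g i"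
    using lo c U by (intro relax_mono) (auto simp: conserved_feq)
  moreover have "relax lam \<phi> L ws wa g i \<le> relax lam \<phi> L ws wa (\<lambda>i. feq lam \<phi> L i U) i"
    using hi c U by (intro relax_mono) (auto simp: conserved_feq)
  ultimately show "relax lam \<phi> L ws wa g i \<in> {feq lam \<phi> L i (-U)..feq lam \<phi> L i U}"
    by (simp add: relax_feq)
qed

lemma lbm_box:
  assumes init: "\<And>j. j \<in> {0..int J - 1} \<times> {0..int J - 1} \<Longrightarrow> cell_avg J u0 j \<in> {-U..U}"
    and bdry: "\<And>\<alpha> n k. n < N \<Longrightarrow> k \<in> {0..int J - 1} \<Longrightarrow> bdry_avg lam J (ub \<alpha>) n k \<in> {-U..U}"
    and "n \<le> N" and "j \<in> {0..int J - 1} \<times> {0..int J - 1}"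
  shows "lbm lam \<phi> L ws wa J u0 ub n i j \<in> {feq lam \<phi> L i (-U)..feq lam \<phi> L i U}"
  using assms(3,4)
proof (induction n arbitrary: i j)
  case 0
  then show ?case
    using init[of j] by (auto intro!: feq_mono)
next
  case (Suc n)
  define b where "b = (\<lambda>\<alpha> i k. feq lam \<phi> L i (bdry_avg lam J (ub \<alpha>) n k))"
  define g where "g = (\<lambda>i j. relax lam \<phi> L ws wa (\<lambda>i'. lbm lam \<phi> L ws wa J u0 ub n i' j) i)"
  let ?B = "\<lambda>i. {feq lam \<phi> L i (-U)..feq lam \<phi> L i U}"
  have b: "b \<alpha> i k \<in> ?B i" if "k \<in> {0..int J - 1}" for \<alpha> i k
    using bdry[of n k \<alpha>] that Suc.prems(1) unfolding b_def by (auto intro!: feq_mono)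
  have g: "g i j \<in> ?B i" if "j \<in> {0..int J - 1} \<times> {0..int J - 1}" for i j
    unfolding g_def by (rule relax_box(1), rule Suc.IH) (use Suc.prems(1) that in auto)
  obtain p q where j: "j = (p, q)" and pq: "p \<in> {0..int J - 1}" "q \<in> {0..int J - 1}"
    using Suc.prems(2) by auto
  have "transport J b g i (p, q) \<in> ?B i"
  proof (cases i)
    case Rest
    then show ?thesis using g[of "(p, q)" i] pq by simp
  next
    case (Pos a)
    then show ?thesis
      \<comment> \<open>The ghost value enters exactly when the decreased index is
        \<open>-1\<close>; otherwise the source cell lies in the grid.\<close>
      using b[OF pq(2), of West i] b[OF pq(1), of South i] g[of "(p - 1, q)" i] g[of "(p, q - 1)" i] pq
      by (cases a) auto
  next
    case (Neg a)
    then show ?thesis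
      using b[OF pq(2), of East i] b[OF pq(1), of North i] g[of "(p + 1, q)" i] g[of "(p, q + 1)" i] pq
      by (cases a) auto
  qed
  then show ?case
    by (simp only: lbm.simps b_def g_def j)
qed

end

section \<open>The maximum principle for the given data\<close>

theorem proposition7:
  fixes T lam :: real
    and \<phi> :: "axis \<Rightarrow> real \<Rightarrow> real"
    and L :: "axis \<Rightarrow> real"
    and ws wa :: real
    and J N :: nat
    and u0 :: "real \<times> real \<Rightarrow> real"
    and ub :: "side \<Rightarrow> real \<times> real \<Rightarrow> real"
  assumes "T > 0" and "lam > 0"
    and "\<And>a. \<phi> a C1_differentiable_on UNIV" and "\<And>a. \<phi> a 0 = 0"
    and "u0 \<in> Linf ({0<..<1} \<times> {0<..<1}) \<inter> BV ({0<..<1} \<times> {0<..<1})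
               \<inter> L1 ({0<..<1} \<times> {0<..<1})"
    and "\<And>\<alpha>. ub \<alpha> \<in> Linf ({0<..<T} \<times> {0<..<1}) \<inter> BV ({0<..<T} \<times> {0<..<1})
               \<inter> L1 ({0<..<T} \<times> {0<..<1})"
    and "ws \<in> {0<..2}" and "wa \<in> {0<..2}"
    and "J \<ge> 1" and "N \<ge> 1" and "real N * dt lam J = T"
    and "\<not> (max_abs_deriv (\<phi> Xax) (u_inf T u0 ub) = 0 \<and>
            max_abs_deriv (\<phi> Yax) (u_inf T u0 ub) = 0)"
    and "monotonicity_cond lam \<phi> L ws wa (u_inf T u0 ub)"
  shows "\<forall>n\<in>{0..N}. \<forall>j\<in>{0..int J - 1} \<times> {0..int J - 1}.
    (\<forall>i. lbm lam \<phi> L ws wa J u0 ub n i j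
           \<in> {feq lam \<phi> L i (- u_inf T u0 ub) .. feq lam \<phi> L i (u_inf T u0 ub)}) \<and>
    conserved (\<lambda>i. lbm lam \<phi> L ws wa J u0 ub n i j) \<in> {- u_inf T u0 ub .. u_inf T u0 ub}"
proof -
  define U where "U = u_inf T u0 ub"
  have u0: "u0 \<in> Linf ({0<..<1} \<times> {0<..<1})" and ub: "\<And>\<alpha>. ub \<alpha> \<in> Linf ({0<..<T} \<times> {0<..<1})"
    using assms(5,6) by blast+
  have le0: "Linf_norm ({0<..<1} \<times> {0<..<1}) u0 \<le> U"
    by (simp add: U_def u_inf_def)
  have leb: "Linf_norm ({0<..<T} \<times> {0<..<1}) (ub \<alpha>) \<le> U" for \<alpha>
    unfolding U_def u_inf_def by (rule max.coboundedI2, rule Max_ge) (cases \<alpha>; auto)+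
  have U: "0 \<le> U"
    using Linf_norm_nonneg[OF u0] le0 by linarith
  interpret monotone_scheme lam \<phi> L ws wa U
    using assms(2,3,7,8,13) U by unfold_locales (auto simp: U_def)
  have op: "{0<..<c} \<times> {0<..<1 :: real} \<in> sets lebesgue" for c :: real
    by (simp add: borel_open open_Times)
  have init: "cell_avg J u0 j \<in> {-U..U}" if "j \<in> {0..int J - 1} \<times> {0..int J - 1}" for j
  proof (rule cell_avg_bound[OF assms(9) that U])
    show "AE z in lborel. z \<in> {0<..<1} \<times> {0<..<1} \<longrightarrow> \<bar>u0 z\<bar> \<le> U"
      using Linf_AE_bound[OF u0 op] by eventually_elim (use le0 in auto)
  qed
  have bdry: "bdry_avg lam J (ub \<alpha>) n k \<in> {-U..U}" if "n < N" "k \<in> {0..int J - 1}" for \<alpha> n k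
  proof (rule bdry_avg_bound[OF assms(9,2) that(1) assms(11) that(2) U])
    show "AE z in lborel. z \<in> {0<..<T} \<times> {0<..<1} \<longrightarrow> \<bar>ub \<alpha> z\<bar> \<le> U"
      using Linf_AE_bound[OF ub op, of \<alpha>] by eventually_elim (use leb[of \<alpha>] in auto)
  qed
  show ?thesis
    unfolding U_def[symmetric]
    \<comment> \<open>The bound on the conserved quantity follows from the box at the same time
      level, so it also covers \<open>n = N\<close>.\<close>
    using lbm_box[OF init bdry] relax_box(2)[OF lbm_box[OF init bdry]] by auto
qed

end
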